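(* For $n\ge 0$, the map $\lambda\mapsto\mathcal{C}_\lambda$ is a bijection from the set of noncrossing partitions of size $n$ to the set $S_n/\!\sim$ of excedance classes of $S_n$.
   Context: Write $[n] = \{1,\dots,n\}$ and let $S_n$ be the group of permutations of $[n]$, with $w_i = w(i)$. A noncrossing partition of size $n$ is a set $\lambda$ of arcs $(i,j)$ with $1 \le i < j \le n$ such that there are no two distinct arcs $(i,k), (j,l) \in \lambda$ with $i \le j < k \le l$. $\lambda^{+}$ (resp. $\lambda^{-}$) denotes the set of all left (resp. right) endpoints of arcs of $\lambda$, where $(i,j)$ has left endpoint $i$ and right endpoint $j$. For $w \in S_n$, set $E_{pos}(w) = \{ i \in [n] : i \le w_i\}$ and $E_{val}(w) = \{ w_i : i\in[n],\ i \le w_i\}$. The excedance relation on $S_n$ is: $v \sim w$ iff $E_{val}(v) = E_{val}(w)$ and $E_{pos}(v)=E_{pos}(w)$; its equivalence classes are called excedance classes. For a noncrossing partition $\lambda$ of size $n$, $\mathcal{C}_\lambda = \{ w \in S_n : E_{val}(w) = [n] \setminus \lambda^{+} \text{ and } E_{pos}(w) = [n]\setminus \lambda^{-}\}$. *)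

theory Defs
  imports "HOL-Combinatorics.Permutations"
begin

definition sym_group :: "nat \<Rightarrow> (nat \<Rightarrow> nat) set" where
  "sym_group n = {w. w permutes {1..n}}"

definition noncrossing_partition :: "nat \<Rightarrow> (nat \<times> nat) set \<Rightarrow> bool" where
  "noncrossing_partition n lam \<longleftrightarrow>
     lam \<subseteq> {(i, j). 1 \<le> i \<and> i < j \<and> j \<le> n} \<and>
     \<not> (\<exists>i j k l. (i, k) \<in> lam \<and> (j, l) \<in> lam \<and> (i, k) \<noteq> (j, l)
           \<and> i \<le> j \<and> j < k \<and> k \<le> l)"

definition left_endpoints :: "(nat \<times> nat) set \<Rightarrow> nat set" where
  "left_endpoints lam = fst ` lam"

definition right_endpoints :: "(nat \<times> nat) set \<Rightarrow> nat set" where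
  "right_endpoints lam = snd ` lam"

definition E_pos :: "nat \<Rightarrow> (nat \<Rightarrow> nat) \<Rightarrow> nat set" where
  "E_pos n w = {i \<in> {1..n}. i \<le> w i}"

definition E_val :: "nat \<Rightarrow> (nat \<Rightarrow> nat) \<Rightarrow> nat set" where
  "E_val n w = {w i | i. i \<in> {1..n} \<and> i \<le> w i}"

definition excedance_rel :: "nat \<Rightarrow> ((nat \<Rightarrow> nat) \<times> (nat \<Rightarrow> nat)) set" where
  "excedance_rel n = {(v, w). v \<in> sym_group n \<and> w \<in> sym_group n \<and>
     E_val n v = E_val n w \<and> E_pos n v = E_pos n w}"

lemma equiv_excedance_rel: "equiv (sym_group n) (excedance_rel n)"
  by (rule equivI) (auto simp: excedance_rel_def refl_on_def sym_def trans_def)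

definition C_class :: "nat \<Rightarrow> (nat \<times> nat) set \<Rightarrow> (nat \<Rightarrow> nat) set" where
  "C_class n lam = {w \<in> sym_group n.
     E_val n w = {1..n} - left_endpoints lam \<and> E_pos n w = {1..n} - right_endpoints lam}"

end

theory Submission
  imports Defs
begin

text \<open>
  An element of \<open>C_class n lam\<close> restricts to a bijection \<open>f\<close> from the right endpoints \<open>B\<close> of \<open>lam\<close>
  onto its left endpoints \<open>A\<close> with \<open>f b < b\<close>.
  In a noncrossing partition the smallest right endpoint \<open>b\<close> must be joined to the largest left
  endpoint \<open>a < b\<close>; removing this arc and recursing shows that the pair \<open>(A, B)\<close> determines \<open>lam\<close>,
  and also that every pair \<open>(A, B)\<close> admitting such a bijection \<open>f\<close> comes from some \<open>lam\<close>.
  Conversely a permutation in \<open>C_class n lam\<close> is built from the identity by one transposition per arc.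
\<close>

section \<open>Noncrossing partitions and their endpoint sets\<close>

lemma noncrossing_partition_arcD:
  assumes "noncrossing_partition n lam" "(i, j) \<in> lam"
  shows "1 \<le> i" "i < j" "j \<le> n"
  using assms unfolding noncrossing_partition_def by auto

lemma noncrossing_partition_crossingD:
  assumes "noncrossing_partition n lam" "(i, k) \<in> lam" "(j, l) \<in> lam" "i \<le> j" "j < k" "k \<le> l"
  shows "i = j \<and> k = l"
  using assms unfolding noncrossing_partition_def by blast

lemma noncrossing_partition_subset:
  "noncrossing_partition n lam \<Longrightarrow> mu \<subseteq> lam \<Longrightarrow> noncrossing_partition n mu"
  unfolding noncrossing_partition_def by blast

lemma noncrossing_partition_finite:
  assumes "noncrossing_partition n lam"
  shows "finite lam"
proof (rule finite_subset)
  show "lam \<subseteq> {1..n} \<times> {1..n}"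
    using noncrossing_partition_arcD[OF assms] by fastforce
qed simp

text \<open>The inequalities \<open>i \<le> j\<close> and \<open>k \<le> l\<close> in the crossing
  condition are weak, so two distinct arcs sharing a left or a right endpoint already count as
  crossing.\<close>

lemma noncrossing_partition_inj_on:
  assumes "noncrossing_partition n lam"
  shows "inj_on fst lam" "inj_on snd lam"
proof -
  have "k = l" if "(i, k) \<in> lam" "(i, l) \<in> lam" for i k l
    using noncrossing_partition_crossingD[OF assms that] noncrossing_partition_arcD[OF assms]
      noncrossing_partition_crossingD[OF assms that(2,1)] that
    by (metis le_cases)
  then show "inj_on fst lam" by (auto simp: inj_on_def)
  have "i = j" if "(i, k) \<in> lam" "(j, k) \<in> lam" for i j k
    using noncrossing_partition_crossingD[OF assms that] noncrossing_partition_arcD[OF assms]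
      noncrossing_partition_crossingD[OF assms that(2,1)] that
    by (metis le_cases)
  then show "inj_on snd lam" by (auto simp: inj_on_def)
qed

lemma noncrossing_partition_innermost:
  assumes nc: "noncrossing_partition n lam" and "lam \<noteq> {}"
  defines "b \<equiv> Min (right_endpoints lam)"
  shows "(Max {x \<in> left_endpoints lam. x < b}, b) \<in> lam"
proof -
  define a where "a = Max {x \<in> left_endpoints lam. x < b}"
  have fin: "finite lam" using nc by (rule noncrossing_partition_finite)
  then have "b \<in> right_endpoints lam"
    unfolding b_def right_endpoints_def using \<open>lam \<noteq> {}\<close> by (intro Min_in) auto
  then obtain x where x: "(x, b) \<in> lam" unfolding right_endpoints_def by auto
  have finA: "finite {x \<in> left_endpoints lam. x < b}" by simp
  have xA: "x \<in> {x \<in> left_endpoints lam. x < b}"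
    using x noncrossing_partition_arcD[OF nc x] by (force simp: left_endpoints_def)
  have "a \<in> {x \<in> left_endpoints lam. x < b}"
    unfolding a_def using finA xA by (intro Max_in) auto
  then obtain y where y: "(a, y) \<in> lam" "a < b" by (auto simp: left_endpoints_def)
  have "x \<le> a" unfolding a_def using finA xA by (rule Max_ge)
  moreover have "b \<le> y"
    unfolding b_def right_endpoints_def using y fin by (intro Min_le) force+
  \<comment> \<open>Here \<open>x \<le> a < b \<le> y\<close>, so the arcs \<open>(x, b)\<close> and
    \<open>(a, y)\<close> would cross unless they coincide.\<close>
  ultimately have "x = a"
    using noncrossing_partition_crossingD[OF nc x y(1)] y by blast
  then show ?thesis using x by (simp add: a_def)
qed

lemma endpoints_remove_arc:
  assumes "noncrossing_partition n lam" "(a, b) \<in> lam"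
  shows "left_endpoints (lam - {(a, b)}) = left_endpoints lam - {a}"
    and "right_endpoints (lam - {(a, b)}) = right_endpoints lam - {b}"
  using noncrossing_partition_inj_on[OF assms(1)] assms(2)
  by (simp_all add: left_endpoints_def right_endpoints_def inj_on_image_set_diff[of _ lam])

lemma noncrossing_partition_eqI:
  assumes "noncrossing_partition n lam" "noncrossing_partition n mu"
    and "left_endpoints lam = left_endpoints mu" "right_endpoints lam = right_endpoints mu"
  shows "lam = mu"
  using assms
proof (induction "card lam" arbitrary: lam mu)
  case 0
  then have "lam = {}" using noncrossing_partition_finite by auto
  then show ?case using 0 by (auto simp: left_endpoints_def)
next
  case (Suc c)
  have ne: "lam \<noteq> {}" "mu \<noteq> {}"
    using Suc.hyps(2) Suc.prems(3) by (auto simp: left_endpoints_def)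
  define b where "b = Min (right_endpoints lam)"
  define a where "a = Max {x \<in> left_endpoints lam. x < b}"
  have lam: "(a, b) \<in> lam"
    using noncrossing_partition_innermost[OF Suc.prems(1) ne(1)] by (simp add: a_def b_def)
  \<comment> \<open>\<open>a\<close> and \<open>b\<close> are computed from the endpoint sets alone,
    and these agree for \<open>lam\<close> and \<open>mu\<close>.\<close>
  have mu: "(a, b) \<in> mu"
    using noncrossing_partition_innermost[OF Suc.prems(2) ne(2)] Suc.prems
    by (simp add: a_def b_def)
  have "lam - {(a, b)} = mu - {(a, b)}"
  proof (rule Suc.hyps(1))
    show "c = card (lam - {(a, b)})" using Suc.hyps(2) lam by simp
  qed (use Suc.prems noncrossing_partition_subset endpoints_remove_arc lam mu in auto)
  then show ?case using lam mu by blast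
qed

section \<open>Noncrossing partitions from matchings\<close>

text \<open>Every old arc ends after \<open>b\<close> and starts either before \<open>a\<close> or
  not before \<open>b\<close>. It therefore encloses the new arc or lies to its right, possibly
  touching it at \<open>b\<close>, which is allowed.\<close>

lemma noncrossing_partition_insert:
  assumes nc: "noncrossing_partition n lam" and ab: "1 \<le> a" "a < b" "b \<le> n"
    and "a \<notin> left_endpoints lam"
    and right: "\<And>k. k \<in> right_endpoints lam \<Longrightarrow> b < k"
    and left: "\<And>i. i \<in> left_endpoints lam \<Longrightarrow> i < b \<Longrightarrow> i \<le> a"
  shows "noncrossing_partition n (insert (a, b) lam)"
proof -
  have arc: "b < k \<and> (i < a \<or> b \<le> i)" if "(i, k) \<in> lam" for i k
  proof -
    have "i \<in> left_endpoints lam" "k \<in> right_endpoints lam"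
      using that by (force simp: left_endpoints_def right_endpoints_def)+
    then show ?thesis using right left[of i] \<open>a \<notin> left_endpoints lam\<close>
      by (metis le_neq_implies_less not_le)
  qed
  have cross: "False" if "(i, k) \<in> insert (a, b) lam" "(j, l) \<in> insert (a, b) lam"
      "(i, k) \<noteq> (j, l)" "i \<le> j" "j < k" "k \<le> l" for i j k l
    using that noncrossing_partition_crossingD[OF nc, of i k j l] arc[of i k] arc[of j l]
    by auto
  show ?thesis
    unfolding noncrossing_partition_def
    using cross nc ab by (auto simp: noncrossing_partition_def)
qed

lemma ex_noncrossing_partition_of_matching:
  assumes "finite B" "inj_on f B" "\<And>b. b \<in> B \<Longrightarrow> 1 \<le> f b \<and> f b < b \<and> b \<le> n"
  shows "\<exists>lam. noncrossing_partition n lam \<and> left_endpoints lam = f ` B \<and> right_endpoints lam = B"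
  using assms
proof (induction B arbitrary: f rule: finite_linorder_min_induct)
  case empty
  show ?case
    by (rule exI[of _ "{}"])
      (simp add: noncrossing_partition_def left_endpoints_def right_endpoints_def)
next
  case (insert b B)
  define X where "X = {x \<in> f ` insert b B. x < b}"
  define a where "a = Max X"
  have "finite X" "f b \<in> X" using insert unfolding X_def by auto
  then have "a \<in> X" "f b \<le> a" unfolding a_def by (auto intro: Max_in)
  then obtain y where y: "y \<in> insert b B" "f y = a" and "a < b" by (auto simp: X_def)
  have "b \<notin> B" using insert by auto
  \<comment> \<open>The arc ending at \<open>b\<close> must start at \<open>a\<close>, but
    \<open>f\<close> may match \<open>a\<close> with some \<open>y\<close> other than
    \<open>b\<close>. Then \<open>y\<close> takes over the value \<open>f b\<close>, which is
    admissible because \<open>f b \<le> a = f y < y\<close>. So \<open>g\<close> matches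
    \<open>B\<close> with the remaining left endpoints.\<close>
  define g where "g = f(y := f b)"
  have inj: "inj_on g B"
    using insert.prems(1) \<open>b \<notin> B\<close> unfolding g_def inj_on_def by auto
  have img: "g ` B = f ` insert b B - {a}"
  proof (cases "y = b")
    case True
    then show ?thesis using insert.prems(1) \<open>b \<notin> B\<close> y unfolding g_def inj_on_def by auto
  next
    case False
    then have "y \<in> B" using y by auto
    then have "g ` B = insert (f b) (f ` (B - {y}))" unfolding g_def by auto
    also have "\<dots> = f ` (insert b B - {y})" using False by auto
    also have "\<dots> = f ` insert b B - {a}"
      using insert.prems(1) y inj_on_image_set_diff[of f "insert b B" "insert b B" "{y}"] by auto
    finally show ?thesis .
  qed
  have "1 \<le> g x \<and> g x < x \<and> x \<le> n" if "x \<in> B" for x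
    using that insert.prems(2)[of x] insert.prems(2)[of b] insert.hyps \<open>f b \<le> a\<close> y
    unfolding g_def by auto
  from insert.IH[OF inj this] obtain lam where lam: "noncrossing_partition n lam"
    "left_endpoints lam = g ` B" "right_endpoints lam = B" by blast
  have "noncrossing_partition n (insert (a, b) lam)"
  proof (rule noncrossing_partition_insert[OF lam(1)])
    show "1 \<le> a" using insert.prems(2)[OF y(1)] y by simp
    show "b \<le> n" using insert.prems(2)[of b] by simp
    show "i \<le> a" if "i \<in> left_endpoints lam" "i < b" for i
      using that lam(2) img \<open>finite X\<close> unfolding a_def by (intro Max_ge) (auto simp: X_def)
  qed (use lam img insert.hyps \<open>a < b\<close> in auto)
  moreover have "left_endpoints (insert (a, b) lam) = f ` insert b B"
    using lam(2) img \<open>a \<in> X\<close> by (auto simp: left_endpoints_def X_def)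
  moreover have "right_endpoints (insert (a, b) lam) = insert b B"
    using lam(3) by (simp add: right_endpoints_def)
  ultimately show ?case by blast
qed

section \<open>Permutations with prescribed excedance sets\<close>

lemma E_val_eq_image: "E_val n w = w ` E_pos n w"
  unfolding E_val_def E_pos_def by auto

text \<open>Arcs are added one at a time. Since left endpoints are distinct and right endpoints are
  distinct, \<open>i\<close> is still an excedance value and \<open>j\<close> still an excedance
  position when the arc \<open>(i, j)\<close> is added; one transposition removes both.\<close>

lemma ex_C_class_of_matching:
  assumes "finite lam" "lam \<subseteq> {(i, j). 1 \<le> i \<and> i < j \<and> j \<le> n}" "inj_on fst lam" "inj_on snd lam"
  shows "\<exists>w. w \<in> C_class n lam"
  using assms
proof (induction lam rule: finite_induct)
  case empty
  have "id \<in> C_class n {}"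
    by (auto simp: C_class_def sym_group_def E_val_def E_pos_def left_endpoints_def
        right_endpoints_def permutes_id)
  then show ?case by blast
next
  case (insert arc lam)
  obtain i j where arc: "arc = (i, j)" by (cases arc)
  have ij: "1 \<le> i" "i < j" "j \<le> n" using insert.prems(1) arc by auto
  have new: "i \<notin> left_endpoints lam" "j \<notin> right_endpoints lam"
    using insert.prems(2,3) insert.hyps arc
    by (auto simp: left_endpoints_def right_endpoints_def)
  obtain w where "w \<in> C_class n lam" using insert by (auto simp: inj_on_insert)
  then have w: "w permutes {1..n}" and val: "w ` E_pos n w = {1..n} - left_endpoints lam"
    and pos: "E_pos n w = {1..n} - right_endpoints lam"
    by (auto simp: C_class_def sym_group_def E_val_eq_image)
  have "i \<in> w ` E_pos n w" using val new ij by auto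
  then obtain p where p: "p \<in> E_pos n w" "w p = i" by auto
  have j: "j \<in> E_pos n w" using pos new ij by auto
  have le: "p \<le> i" "1 \<le> p" "p \<le> n" "j \<le> w j" using p j by (auto simp: E_pos_def)
  \<comment> \<open>The new values satisfy \<open>v j = i < j\<close> and \<open>p \<le> i < j \<le> w j = v p\<close>,
    so \<open>j\<close> is the only position that stops being a weak excedance.\<close>
  define v where "v = w \<circ> transpose p j"
  have "v permutes {1..n}"
    unfolding v_def using w le ij by (intro permutes_compose permutes_swap_id) auto
  moreover have Ev: "E_pos n v = E_pos n w - {j}"
    using le ij p by (auto simp: E_pos_def v_def transpose_def)
  moreover have "v ` E_pos n v = w ` E_pos n w - {i}"
  proof -
    \<comment> \<open>Dropping position \<open>j\<close> from \<open>v\<close> amounts to dropping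
      position \<open>p\<close> from \<open>w\<close>, so the value lost is
      \<open>w p = i\<close>.\<close>
    have "transpose p j ` (E_pos n w - {j}) = E_pos n w - {p}"
      using p(1) j by (auto simp: transpose_def image_iff)
    then have "v ` E_pos n v = w ` (E_pos n w - {p})"
      by (simp only: Ev) (simp only: v_def image_comp[symmetric])
    also have "\<dots> = w ` E_pos n w - {i}"
      using p by (simp add: image_set_diff[OF permutes_inj[OF w]])
    finally show ?thesis .
  qed
  ultimately have "v \<in> C_class n (insert arc lam)"
    using val pos arc
    by (auto simp: C_class_def sym_group_def E_val_eq_image left_endpoints_def right_endpoints_def)
  then show ?case by blast
qed

section \<open>Excedance classes and the bijection\<close>

lemma C_class_eq_excedance_class:
  "w \<in> C_class n lam \<Longrightarrow> C_class n lam = excedance_rel n `` {w}"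
  by (auto simp: C_class_def excedance_rel_def)

text \<open>An equivalence class is never empty, so a member is what makes
  \<open>C_class n lam\<close> an excedance class. For injectivity, a common member recovers the
  endpoint sets.\<close>

lemma C_class_nonempty:
  assumes "noncrossing_partition n lam"
  shows "\<exists>w. w \<in> C_class n lam"
proof (rule ex_C_class_of_matching)
  show "lam \<subseteq> {(i, j). 1 \<le> i \<and> i < j \<and> j \<le> n}"
    using assms by (simp add: noncrossing_partition_def)
qed (use assms noncrossing_partition_finite noncrossing_partition_inj_on in blast)+

lemma ex_noncrossing_partition_of_perm:
  assumes "w \<in> sym_group n"
  shows "\<exists>lam. noncrossing_partition n lam \<and> w \<in> C_class n lam"
proof -
  have w: "w permutes {1..n}" using assms by (simp add: sym_group_def)
  define B where "B = {1..n} - E_pos n w"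
  have "1 \<le> w b \<and> w b < b \<and> b \<le> n" if "b \<in> B" for b
    using that permutes_in_image[OF w, of b] by (auto simp: B_def E_pos_def)
  moreover have "finite B" by (simp add: B_def)
  ultimately obtain lam where lam: "noncrossing_partition n lam" "left_endpoints lam = w ` B"
    "right_endpoints lam = B"
    using ex_noncrossing_partition_of_matching[of B w n] permutes_inj_on[OF w] by blast
  have "E_pos n w \<subseteq> {1..n}" by (auto simp: E_pos_def)
  moreover have "w ` B = {1..n} - w ` E_pos n w"
    unfolding B_def by (simp only: image_set_diff[OF permutes_inj[OF w]] permutes_image[OF w])
  moreover have "w ` E_pos n w \<subseteq> {1..n}"
    using calculation(1) permutes_image[OF w] by blast
  ultimately have "w \<in> C_class n lam"
    using assms lam by (auto simp: C_class_def E_val_eq_image B_def)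
  then show ?thesis using lam(1) by blast
qed

text \<open>This allows the endpoint sets to be recovered from their complements in
  \<open>{1..n}\<close>.\<close>

lemma endpoints_subset:
  assumes "noncrossing_partition n lam"
  shows "left_endpoints lam \<subseteq> {1..n}" "right_endpoints lam \<subseteq> {1..n}"
  using noncrossing_partition_arcD[OF assms]
  by (fastforce simp: left_endpoints_def right_endpoints_def)+

theorem proposition4p5:
  fixes n :: nat
  shows "bij_betw (C_class n) {lam. noncrossing_partition n lam}
           (sym_group n // excedance_rel n)"
  unfolding bij_betw_def
proof
  show "inj_on (C_class n) {lam. noncrossing_partition n lam}"
  proof (rule inj_onI, clarsimp)
    fix lam mu
    assume nc: "noncrossing_partition n lam" "noncrossing_partition n mu"
      and eq: "C_class n lam = C_class n mu"
    obtain w where "w \<in> C_class n lam" "w \<in> C_class n mu"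
      using C_class_nonempty[OF nc(1)] eq by auto
    then have "{1..n} - left_endpoints lam = {1..n} - left_endpoints mu"
      "{1..n} - right_endpoints lam = {1..n} - right_endpoints mu"
      by (auto simp: C_class_def)
    then show "lam = mu"
      using endpoints_subset[OF nc(1)] endpoints_subset[OF nc(2)]
      by (intro noncrossing_partition_eqI[OF nc]) (metis double_diff order_refl)+
  qed
  show "C_class n ` {lam. noncrossing_partition n lam} = sym_group n // excedance_rel n"
  proof (intro subset_antisym subsetI)
    fix S assume "S \<in> C_class n ` {lam. noncrossing_partition n lam}"
    then obtain lam w where "S = C_class n lam" "w \<in> C_class n lam"
      using C_class_nonempty by blast
    moreover from this have "w \<in> sym_group n" by (simp add: C_class_def)
    ultimately show "S \<in> sym_group n // excedance_rel n"
      by (metis C_class_eq_excedance_class quotientI)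
  next
    fix S assume "S \<in> sym_group n // excedance_rel n"
    then obtain w where "w \<in> sym_group n" "S = excedance_rel n `` {w}" by (rule quotientE)
    then show "S \<in> C_class n ` {lam. noncrossing_partition n lam}"
      using ex_noncrossing_partition_of_perm C_class_eq_excedance_class by blast
  qed
qed

end
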